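(* Let $\Phi$ be a finite irreducible crystallographic root system with simple system $\Pi$, let $S\subseteq\Pi$ and $\beta\in\Phi$ with $S\cap\mathrm{Supp}(\beta)\ne\emptyset$. The set $\Phi_{S,\beta}$ contains long roots if and only if, for every short root $\alpha$ in $S$, the coefficient $c_\alpha(\beta)$ is a multiple of the lacing number of $\Phi$.
   Context: $\Phi$ is reduced, in a Euclidean space with Weyl-group-invariant form $(\cdot,\cdot)$. Each root $\gamma$ is written $\gamma=\sum_{\alpha\in\Pi}c_\alpha(\gamma)\alpha$; $\mathrm{Supp}(\gamma)=\{\alpha\in\Pi:c_\alpha(\gamma)\ne0\}$. Define $\Phi_{S,\beta}=\{\gamma\in\Phi:c_\alpha(\gamma)=c_\alpha(\beta)\ \forall\alpha\in S\}$. The lacing number of $\Phi$ is $\max\{(\alpha,\alpha)/(\beta,\beta):\alpha,\beta\in\Phi\}$. In simply laced root systems all roots are considered long. *)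

theory Defs
  imports "HOL-Analysis.Analysis"
begin

text \<open>
  The invariant form is the inner product of the ambient Euclidean space, and the reflections
  are the orthogonal ones.
\<close>

definition reflection :: "'a::euclidean_space \<Rightarrow> 'a \<Rightarrow> 'a" where
  "reflection \<alpha> x = x - (2 * (x \<bullet> \<alpha>) / (\<alpha> \<bullet> \<alpha>)) *\<^sub>R \<alpha>"

text \<open>
  Finite reduced crystallographic root systems.  The roots are not required to span the ambient
  space, so that for instance the usual model of type \<open>A\<^sub>n\<close> in dimension \<open>n + 1\<close> is covered.
\<close>

definition root_system :: "'a::euclidean_space set \<Rightarrow> bool" where
  "root_system \<Phi> \<longleftrightarrow>
     finite \<Phi> \<and> 0 \<notin> \<Phi> \<and>
     (\<forall>\<alpha>\<in>\<Phi>. reflection \<alpha> ` \<Phi> = \<Phi>) \<and>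
     (\<forall>\<alpha>\<in>\<Phi>. \<forall>\<beta>\<in>\<Phi>. 2 * (\<beta> \<bullet> \<alpha>) / (\<alpha> \<bullet> \<alpha>) \<in> \<int>) \<and>
     (\<forall>\<alpha>\<in>\<Phi>. \<forall>c. c *\<^sub>R \<alpha> \<in> \<Phi> \<longrightarrow> c = 1 \<or> c = -1)"

definition irreducible_root_system :: "'a::euclidean_space set \<Rightarrow> bool" where
  "irreducible_root_system \<Phi> \<longleftrightarrow>
     root_system \<Phi> \<and> \<Phi> \<noteq> {} \<and>
     \<not> (\<exists>A B. A \<noteq> {} \<and> B \<noteq> {} \<and> A \<inter> B = {} \<and> A \<union> B = \<Phi> \<and> (\<forall>a\<in>A. \<forall>b\<in>B. a \<bullet> b = 0))"

text \<open>
  The coefficient of the simple root \<open>\<alpha>\<close> in \<open>\<gamma>\<close> is \<open>representation \<Delta> \<gamma> \<alpha>\<close>; it is a real number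
  by type, hence the explicit integrality below.  The library sets \<open>representation \<Delta> \<gamma>\<close> to
  \<open>0\<close> outside the span of \<open>\<Delta>\<close>, hence the explicit membership in the span.
\<close>

definition simple_system :: "'a::euclidean_space set \<Rightarrow> 'a set \<Rightarrow> bool" where
  "simple_system \<Phi> \<Delta> \<longleftrightarrow>
     \<Delta> \<subseteq> \<Phi> \<and> independent \<Delta> \<and> \<Phi> \<subseteq> span \<Delta> \<and>
     (\<forall>\<gamma>\<in>\<Phi>. (\<forall>\<alpha>\<in>\<Delta>. representation \<Delta> \<gamma> \<alpha> \<in> \<int>) \<and>
        ((\<forall>\<alpha>\<in>\<Delta>. 0 \<le> representation \<Delta> \<gamma> \<alpha>) \<or> (\<forall>\<alpha>\<in>\<Delta>. representation \<Delta> \<gamma> \<alpha> \<le> 0)))"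

definition root_supp :: "'a::euclidean_space set \<Rightarrow> 'a \<Rightarrow> 'a set" where
  "root_supp \<Delta> \<gamma> = {\<alpha> \<in> \<Delta>. representation \<Delta> \<gamma> \<alpha> \<noteq> 0}"

definition roots_agreeing ::
  "'a::euclidean_space set \<Rightarrow> 'a set \<Rightarrow> 'a set \<Rightarrow> 'a \<Rightarrow> 'a set" where
  "roots_agreeing \<Phi> \<Delta> S \<beta> =
     {\<gamma> \<in> \<Phi>. \<forall>\<alpha>\<in>S. representation \<Delta> \<gamma> \<alpha> = representation \<Delta> \<beta> \<alpha>}"

definition lacing_number :: "'a::euclidean_space set \<Rightarrow> real" where
  "lacing_number \<Phi> = Max {(\<alpha> \<bullet> \<alpha>) / (\<beta> \<bullet> \<beta>) | \<alpha> \<beta>. \<alpha> \<in> \<Phi> \<and> \<beta> \<in> \<Phi>}"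

text \<open>
  If all roots have the same length, then all of them are long and none is short.
\<close>

definition long_root :: "'a::euclidean_space set \<Rightarrow> 'a \<Rightarrow> bool" where
  "long_root \<Phi> \<gamma> \<longleftrightarrow> \<gamma> \<in> \<Phi> \<and> (\<forall>\<delta>\<in>\<Phi>. \<delta> \<bullet> \<delta> \<le> \<gamma> \<bullet> \<gamma>)"

definition short_root :: "'a::euclidean_space set \<Rightarrow> 'a \<Rightarrow> bool" where
  "short_root \<Phi> \<gamma> \<longleftrightarrow> \<gamma> \<in> \<Phi> \<and> \<not> long_root \<Phi> \<gamma>"

end

theory Submission
  imports Defs
begin

text \<open>
  Let \<open>N\<close> be the lattice of all \<open>v\<close> in the root lattice for which the lacing number divides the
  coefficients at the short simple roots.  Long roots lie in \<open>N\<close> by integrality of coroots, which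
  gives one direction.  For the other one, let \<open>\<beta>\<close> be short.  Modulo \<open>N\<close> only the reflections in
  short simple roots act, so \<open>\<beta>\<close> is congruent to a short root \<open>\<eta>\<close> supported on the short simple
  roots.  The presence of a long simple root forces the coefficients of \<open>\<eta>\<close> to be at most \<open>1\<close> in
  absolute value, so by the divisibility hypothesis \<open>\<eta>\<close> vanishes on \<open>S\<close> and \<open>v = \<beta> - \<eta>\<close> has the same
  \<open>S\<close>-coefficients as \<open>\<beta>\<close>.  Since \<open>v \<in> N\<close>, its square norm is a multiple of that of the long roots;
  as \<open>\<beta> \<noteq> \<plusminus>\<eta>\<close>, it is positive and less than twice that value.  Finally, a vector of \<open>N\<close> with
  the square norm of a long root is a root, by descent along simple reflections.
\<close>

section \<open>Reflections\<close>


lemma inner_reflection: "reflection \<alpha> x \<bullet> y = x \<bullet> y - 2 * (x \<bullet> \<alpha>) / (\<alpha> \<bullet> \<alpha>) * (\<alpha> \<bullet> y)"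
  by (simp add: reflection_def inner_diff_left)

lemma reflection_isometry [simp]: "reflection \<alpha> x \<bullet> reflection \<alpha> y = x \<bullet> y"
proof (cases "\<alpha> = 0")
  case False
  then show ?thesis
    by (simp add: reflection_def inner_diff_left inner_diff_right field_simps inner_commute)
qed (simp add: reflection_def)

lemma reflection_involution [simp]: "reflection \<alpha> (reflection \<alpha> x) = x"
proof (cases "\<alpha> = 0")
  case False
  then show ?thesis
    by (simp add: reflection_def inner_diff_left field_simps flip: scaleR_left.add scaleR_left.diff)
qed (simp add: reflection_def)

lemma reflection_self: "reflection \<alpha> \<alpha> = - \<alpha>"
proof (cases "\<alpha> = 0")
  case False
  then have "reflection \<alpha> \<alpha> = \<alpha> - 2 *\<^sub>R \<alpha>"
    by (simp add: reflection_def)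
  then show ?thesis
    by (simp add: scaleR_2)
qed (simp add: reflection_def)

lemma reflection_diff: "reflection \<alpha> (x - y) = reflection \<alpha> x - reflection \<alpha> y"
  by (simp add: reflection_def inner_diff_left algebra_simps diff_divide_distrib)

text \<open>Both \<open>x - y\<close> and \<open>x + y\<close> have positive square norm, so the
  Cartan number lies strictly between -2 and 2. The vectors are arbitrary because the bound is also
  needed for lattice vectors not yet known to be roots.\<close>

lemma abs_cartan_le_1:
  fixes x y :: "'a::real_inner"
  assumes le: "x \<bullet> x \<le> y \<bullet> y" and "y \<noteq> 0" and ne: "x \<noteq> y" "x \<noteq> - y"
    and int: "2 * (x \<bullet> y) / (y \<bullet> y) \<in> \<int>"
  shows "\<bar>2 * (x \<bullet> y) / (y \<bullet> y)\<bar> \<le> 1"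
proof -
  have pos: "y \<bullet> y > 0" using \<open>y \<noteq> 0\<close> by simp
  obtain k :: int where k: "2 * (x \<bullet> y) / (y \<bullet> y) = of_int k"
    using int by (elim Ints_cases)
  have "(x - y) \<bullet> (x - y) > 0" "(x + y) \<bullet> (x + y) > 0"
    using ne by (auto simp: eq_neg_iff_add_eq_0)
  then have "2 * (x \<bullet> y) < 2 * (y \<bullet> y)" "- (2 * (y \<bullet> y)) < 2 * (x \<bullet> y)"
    using le by (auto simp: inner_diff_left inner_diff_right inner_add_left inner_add_right inner_commute)
  then have "of_int k < (2::real)" "(-2::real) < of_int k"
    using pos unfolding k[symmetric] by (auto simp: field_simps)
  then have "- 1 \<le> k" "k \<le> 1" by linarith+
  then show ?thesis unfolding k by (simp add: abs_le_iff)
qed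

section \<open>Simple systems of irreducible root systems\<close>

locale irreducible_based_roots =
  fixes \<Phi> \<Delta> :: "'a::euclidean_space set"
  assumes irreducible: "irreducible_root_system \<Phi>"
    and simple: "simple_system \<Phi> \<Delta>"
begin

abbreviation coeff :: "'a \<Rightarrow> 'a \<Rightarrow> real" where
  "coeff \<equiv> representation \<Delta>"

lemma root_system: "root_system \<Phi>"
  using irreducible by (simp add: irreducible_root_system_def)

lemma finite_roots: "finite \<Phi>"
  using root_system by (simp add: root_system_def)

lemma root_nonzero: "\<gamma> \<in> \<Phi> \<Longrightarrow> \<gamma> \<noteq> 0"
  using root_system by (auto simp: root_system_def)

lemma root_sq_pos: "\<gamma> \<in> \<Phi> \<Longrightarrow> \<gamma> \<bullet> \<gamma> > 0"
  using root_nonzero by simp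

lemma reflection_root: "\<alpha> \<in> \<Phi> \<Longrightarrow> \<gamma> \<in> \<Phi> \<Longrightarrow> reflection \<alpha> \<gamma> \<in> \<Phi>"
  using root_system by (auto simp: root_system_def)

lemma cartan_integer: "\<alpha> \<in> \<Phi> \<Longrightarrow> \<gamma> \<in> \<Phi> \<Longrightarrow> 2 * (\<gamma> \<bullet> \<alpha>) / (\<alpha> \<bullet> \<alpha>) \<in> \<int>"
  using root_system by (simp add: root_system_def)

lemma root_multiple: "\<alpha> \<in> \<Phi> \<Longrightarrow> c *\<^sub>R \<alpha> \<in> \<Phi> \<Longrightarrow> c = 1 \<or> c = -1"
  using root_system by (auto simp: root_system_def)

lemma minus_root: "\<gamma> \<in> \<Phi> \<Longrightarrow> - \<gamma> \<in> \<Phi>"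
  using reflection_root[of \<gamma> \<gamma>] by (simp add: reflection_self)

lemma simple_root: "\<alpha> \<in> \<Delta> \<Longrightarrow> \<alpha> \<in> \<Phi>"
  using simple by (auto simp: simple_system_def)

lemma indep: "independent \<Delta>"
  using simple by (simp add: simple_system_def)

lemma finite_simple: "finite \<Delta>"
  using finite_roots simple_root by (meson finite_subset subsetI)

lemma root_span: "\<gamma> \<in> \<Phi> \<Longrightarrow> \<gamma> \<in> span \<Delta>"
  using simple by (auto simp: simple_system_def)

lemma coeff_int: "\<gamma> \<in> \<Phi> \<Longrightarrow> \<alpha> \<in> \<Delta> \<Longrightarrow> coeff \<gamma> \<alpha> \<in> \<int>"
  using simple by (simp add: simple_system_def)

lemma coeff_sign:
  "\<gamma> \<in> \<Phi> \<Longrightarrow> (\<forall>\<alpha>\<in>\<Delta>. 0 \<le> coeff \<gamma> \<alpha>) \<or> (\<forall>\<alpha>\<in>\<Delta>. coeff \<gamma> \<alpha> \<le> 0)"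
  using simple by (simp add: simple_system_def)

lemma coeff_simple: "\<alpha> \<in> \<Delta> \<Longrightarrow> coeff \<alpha> \<delta> = (if \<delta> = \<alpha> then 1 else 0)"
  using representation_basis[OF indep, of \<alpha>] by simp

lemma coeff_diff: "x \<in> span \<Delta> \<Longrightarrow> y \<in> span \<Delta> \<Longrightarrow> coeff (x - y) \<alpha> = coeff x \<alpha> - coeff y \<alpha>"
  using representation_diff[OF indep, of y x] by simp

lemma coeff_scale: "x \<in> span \<Delta> \<Longrightarrow> coeff (k *\<^sub>R x) \<alpha> = k * coeff x \<alpha>"
  using representation_scale[OF indep, of x k] by simp

lemma coeff_uminus: "x \<in> span \<Delta> \<Longrightarrow> coeff (- x) \<alpha> = - coeff x \<alpha>"
  using representation_neg[OF indep, of x] by simp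

lemma sum_coeff: "x \<in> span \<Delta> \<Longrightarrow> (\<Sum>\<alpha>\<in>\<Delta>. coeff x \<alpha> *\<^sub>R \<alpha>) = x"
  by (rule sum_representation_eq[OF indep _ finite_simple order_refl])

lemma inner_coeff: "x \<in> span \<Delta> \<Longrightarrow> x \<bullet> y = (\<Sum>\<alpha>\<in>\<Delta>. coeff x \<alpha> * (\<alpha> \<bullet> y))"
  by (subst sum_coeff[symmetric]) (simp_all add: inner_sum_left)

lemma reflection_span: "\<alpha> \<in> \<Delta> \<Longrightarrow> x \<in> span \<Delta> \<Longrightarrow> reflection \<alpha> x \<in> span \<Delta>"
  by (simp add: reflection_def span_base span_diff span_scale)

lemma coeff_reflection:
  "\<alpha> \<in> \<Delta> \<Longrightarrow> x \<in> span \<Delta> \<Longrightarrow>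
    coeff (reflection \<alpha> x) \<delta> = coeff x \<delta> - (if \<delta> = \<alpha> then 2 * (x \<bullet> \<alpha>) / (\<alpha> \<bullet> \<alpha>) else 0)"
  by (simp add: reflection_def coeff_diff coeff_scale coeff_simple span_base span_scale)

lemma coeff_eq_0_imp: "x \<in> span \<Delta> \<Longrightarrow> (\<And>\<alpha>. \<alpha> \<in> \<Delta> \<Longrightarrow> coeff x \<alpha> = 0) \<Longrightarrow> x = 0"
  using sum_coeff[of x] by simp

text \<open>Otherwise reflecting \<delta> in \<alpha> would yield a root with coefficient 1 at
  \<delta> and a negative one at \<alpha>.\<close>

lemma simple_obtuse:
  assumes "\<alpha> \<in> \<Delta>" "\<delta> \<in> \<Delta>" "\<alpha> \<noteq> \<delta>"
  shows "\<delta> \<bullet> \<alpha> \<le> 0"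
proof -
  let ?k = "2 * (\<delta> \<bullet> \<alpha>) / (\<alpha> \<bullet> \<alpha>)"
  have c: "coeff (reflection \<alpha> \<delta>) \<delta> = 1" "coeff (reflection \<alpha> \<delta>) \<alpha> = - ?k"
    using assms by (simp_all add: coeff_reflection span_base coeff_simple)
  have "reflection \<alpha> \<delta> \<in> \<Phi>" using assms by (simp add: reflection_root simple_root)
  from coeff_sign[OF this] have "?k \<le> 0" using c assms by force
  then show ?thesis
    using root_sq_pos[OF simple_root[OF assms(1)]] by (simp add: field_simps)
qed

text \<open>Expanding the positive number \<open>x \<bullet> x\<close> along the simple roots leaves
  some positive summand. Reflecting in that \<alpha> moves the coefficient in the direction of zero,
  which drives both descents below.\<close>

lemma ex_coeff_inner_pos:
  assumes "x \<in> span \<Delta>" "x \<noteq> 0"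
  obtains \<alpha> where "\<alpha> \<in> \<Delta>" "coeff x \<alpha> * (x \<bullet> \<alpha>) > 0"
proof -
  have "0 < (\<Sum>\<alpha>\<in>\<Delta>. coeff x \<alpha> * (\<alpha> \<bullet> x))"
    using assms inner_coeff[of x x] by (metis inner_gt_zero_iff)
  then obtain \<alpha> where "\<alpha> \<in> \<Delta>" "coeff x \<alpha> * (\<alpha> \<bullet> x) > 0"
    using sum_nonpos[of \<Delta> "\<lambda>\<alpha>. coeff x \<alpha> * (\<alpha> \<bullet> x)"] by (force simp: not_le)
  then show ?thesis using that by (simp add: inner_commute)
qed

section \<open>Descent along simple reflections and connectedness of the simple system\<close>

text \<open>A natural number, to serve as the measure of a well-founded induction; on integral
  coefficients the floor is exact.\<close>

definition size_coeffs :: "'a \<Rightarrow> nat" where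
  "size_coeffs x = (\<Sum>\<alpha>\<in>\<Delta>. nat \<lfloor>\<bar>coeff x \<alpha>\<bar>\<rfloor>)"

lemma size_reflection_less:
  assumes \<alpha>: "\<alpha> \<in> \<Delta>" and x: "x \<in> span \<Delta>" and int: "coeff x \<alpha> \<in> \<int>"
    "2 * (x \<bullet> \<alpha>) / (\<alpha> \<bullet> \<alpha>) \<in> \<int>"
    and less: "\<bar>coeff x \<alpha> - 2 * (x \<bullet> \<alpha>) / (\<alpha> \<bullet> \<alpha>)\<bar> < \<bar>coeff x \<alpha>\<bar>"
  shows "size_coeffs (reflection \<alpha> x) < size_coeffs x"
proof -
  obtain i j :: int where ij: "coeff x \<alpha> = of_int i" "2 * (x \<bullet> \<alpha>) / (\<alpha> \<bullet> \<alpha>) = of_int j"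
    using int by (metis Ints_cases)
  have "\<bar>i - j\<bar> < \<bar>i\<bar>"
    using less unfolding ij by linarith
  then have l: "nat \<lfloor>\<bar>coeff (reflection \<alpha> x) \<alpha>\<bar>\<rfloor> < nat \<lfloor>\<bar>coeff x \<alpha>\<bar>\<rfloor>"
    using \<alpha> x by (simp add: coeff_reflection ij flip: of_int_diff of_int_abs)
  show ?thesis
    unfolding size_coeffs_def
    by (rule sum_strict_mono_ex1)
      (use \<alpha> x l finite_simple in \<open>auto simp: coeff_reflection less_imp_le\<close>)
qed

text \<open>Descent in \<open>size_coeffs\<close>: a root with a second nonzero coefficient keeps
  its sign under the chosen reflection, so the coefficient at \<alpha> shrinks in absolute value
  without changing sign.\<close>

lemma root_induct [consumes 1, case_names simple reflection]:
  assumes "\<gamma> \<in> \<Phi>"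
    and base: "\<And>\<alpha>. \<alpha> \<in> \<Delta> \<Longrightarrow> P \<alpha>"
    and step: "\<And>\<alpha> \<gamma>. \<alpha> \<in> \<Delta> \<Longrightarrow> \<gamma> \<in> \<Phi> \<Longrightarrow> P \<gamma> \<Longrightarrow> P (reflection \<alpha> \<gamma>)"
  shows "P \<gamma>"
  using assms(1)
proof (induction "size_coeffs \<gamma>" arbitrary: \<gamma> rule: less_induct)
  case less
  have \<gamma>: "\<gamma> \<in> span \<Delta>" "\<gamma> \<noteq> 0" using less.prems by (simp_all add: root_span root_nonzero)
  obtain \<alpha> where \<alpha>: "\<alpha> \<in> \<Delta>" "coeff \<gamma> \<alpha> * (\<gamma> \<bullet> \<alpha>) > 0"
    using ex_coeff_inner_pos[OF \<gamma>] by blast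
  let ?k = "2 * (\<gamma> \<bullet> \<alpha>) / (\<alpha> \<bullet> \<alpha>)"
  have pos: "\<alpha> \<bullet> \<alpha> > 0" using \<alpha>(1) by (intro root_sq_pos simple_root)
  show ?case
  proof (cases "\<exists>\<delta>\<in>\<Delta>. \<delta> \<noteq> \<alpha> \<and> coeff \<gamma> \<delta> \<noteq> 0")
    case True
    \<comment> \<open>The coefficient at \<delta> is untouched by the reflection and fixes the
      common sign of the new coefficients.\<close>
    then obtain \<delta> where \<delta>: "\<delta> \<in> \<Delta>" "\<delta> \<noteq> \<alpha>" "coeff \<gamma> \<delta> \<noteq> 0" by blast
    have r: "reflection \<alpha> \<gamma> \<in> \<Phi>" using \<alpha> less.prems by (simp add: reflection_root simple_root)
    have c: "coeff (reflection \<alpha> \<gamma>) \<delta> = coeff \<gamma> \<delta>" "coeff (reflection \<alpha> \<gamma>) \<alpha> = coeff \<gamma> \<alpha> - ?k"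
      using \<alpha> \<delta> \<gamma> by (simp_all add: coeff_reflection)
    have "\<bar>coeff \<gamma> \<alpha> - ?k\<bar> < \<bar>coeff \<gamma> \<alpha>\<bar>"
    proof (cases "coeff \<gamma> \<alpha> > 0")
      case True
      then have "?k > 0" using \<alpha> pos by (simp add: zero_less_mult_iff)
      moreover have "coeff \<gamma> \<delta> > 0" using coeff_sign[OF less.prems] True \<alpha> \<delta> by force
      moreover have "coeff \<gamma> \<alpha> - ?k \<ge> 0" using coeff_sign[OF r] \<alpha> \<delta> c calculation by force
      ultimately show ?thesis by linarith
    next
      case False
      then have neg: "coeff \<gamma> \<alpha> < 0" "\<gamma> \<bullet> \<alpha> < 0" using \<alpha> by (auto simp: zero_less_mult_iff)
      then have "?k < 0" using pos by (simp add: divide_neg_pos)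
      moreover have "coeff \<gamma> \<delta> < 0" using coeff_sign[OF less.prems] neg \<alpha> \<delta> by force
      moreover have "coeff \<gamma> \<alpha> - ?k \<le> 0" using coeff_sign[OF r] \<alpha> \<delta> c calculation by force
      ultimately show ?thesis by linarith
    qed
    then have "size_coeffs (reflection \<alpha> \<gamma>) < size_coeffs \<gamma>"
      using \<alpha> \<gamma> less.prems by (intro size_reflection_less) (auto simp: coeff_int cartan_integer simple_root)
    from step[OF \<alpha>(1) r less.hyps[OF this r]] show ?thesis by simp
  next
    case False
    \<comment> \<open>Only a multiple of \<alpha> remains, and reducedness makes it \<alpha> or its
      negative, the reflection of \<alpha> in itself.\<close>
    have "(\<Sum>\<delta>\<in>{\<alpha>}. coeff \<gamma> \<delta> *\<^sub>R \<delta>) = (\<Sum>\<delta>\<in>\<Delta>. coeff \<gamma> \<delta> *\<^sub>R \<delta>)"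
      by (rule sum.mono_neutral_left) (use False \<alpha> finite_simple in auto)
    then have g: "\<gamma> = coeff \<gamma> \<alpha> *\<^sub>R \<alpha>" using sum_coeff[OF \<gamma>(1)] by simp
    then have "coeff \<gamma> \<alpha> = 1 \<or> coeff \<gamma> \<alpha> = -1"
      using root_multiple[of \<alpha> "coeff \<gamma> \<alpha>"] less.prems \<alpha>(1) simple_root by metis
    then have "\<gamma> = \<alpha> \<or> \<gamma> = reflection \<alpha> \<alpha>" using g by (metis reflection_self scaleR_minus1_left scaleR_one)
    then show ?thesis using base step \<alpha> simple_root by auto
  qed
qed

text \<open>The Dynkin diagram of an irreducible system is connected: by \<open>root_induct\<close>
  every root would lie in the span of \<open>A\<close> or of \<open>B\<close>, and these two classes
  would decompose \<open>\<Phi>\<close>.\<close>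

lemma simple_connected:
  assumes "A \<union> B = \<Delta>" "A \<noteq> {}" "B \<noteq> {}"
    and orth: "\<And>a b. a \<in> A \<Longrightarrow> b \<in> B \<Longrightarrow> a \<bullet> b = 0"
  shows False
proof -
  have orth_span: "x \<bullet> y = 0" if "x \<in> span A" "y \<in> span B" for x y
  proof -
    have "orthogonal y a" if "a \<in> A" for a
      using orthogonal_to_span[OF \<open>y \<in> span B\<close>, of a] that orth
      by (metis orthogonal_def orthogonal_commute)
    then show ?thesis
      using orthogonal_to_span[OF \<open>x \<in> span A\<close>, of y] by (simp add: orthogonal_def inner_commute)
  qed
  have split: "\<gamma> \<in> span A \<or> \<gamma> \<in> span B" if "\<gamma> \<in> \<Phi>" for \<gamma>
    using that
  proof (induction rule: root_induct)
    case (simple \<alpha>)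
    then show ?case using assms(1) by (auto intro: span_base)
  next
    case (reflection \<alpha> \<gamma>)
    \<comment> \<open>A reflection in a root of the other part fixes \<gamma> by
      orthogonality.\<close>
    have *: "reflection \<alpha> \<gamma> \<in> span C" if "\<gamma> \<in> span C" "\<alpha> \<in> C \<or> \<gamma> \<bullet> \<alpha> = 0" for C
      using that by (auto simp: reflection_def span_base span_diff span_scale)
    from \<open>\<alpha> \<in> \<Delta>\<close> reflection.IH assms(1) show ?case
      using *[of A] *[of B] orth_span[of \<gamma> \<alpha>] orth_span[of \<alpha> \<gamma>]
      by (auto simp: span_base inner_commute)
  qed
  let ?A = "\<Phi> \<inter> span A" and ?B = "\<Phi> \<inter> span B"
  have "?A \<noteq> {}" "?B \<noteq> {}" using assms(1-3) simple_root by (auto intro: span_base)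
  moreover have "?A \<inter> ?B = {}"
    using orth_span root_nonzero by (metis IntE disjoint_iff inner_eq_zero_iff)
  moreover have "?A \<union> ?B = \<Phi>" using split by blast
  moreover have "\<forall>a\<in>?A. \<forall>b\<in>?B. a \<bullet> b = 0" using orth_span by blast
  ultimately have "\<exists>A B. A \<noteq> {} \<and> B \<noteq> {} \<and> A \<inter> B = {} \<and> A \<union> B = \<Phi> \<and> (\<forall>a\<in>A. \<forall>b\<in>B. a \<bullet> b = 0)"
    by (intro exI[of _ ?A] exI[of _ ?B] conjI)
  then show False using irreducible by (simp only: irreducible_root_system_def) simp
qed

section \<open>Root lengths and the lacing number\<close>

definition long_sq :: real where
  "long_sq = Max ((\<lambda>\<gamma>. \<gamma> \<bullet> \<gamma>) ` \<Phi>)"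

lemma roots_nonempty: "\<Phi> \<noteq> {}"
  using irreducible by (simp add: irreducible_root_system_def)

lemma root_sq_le: "\<gamma> \<in> \<Phi> \<Longrightarrow> \<gamma> \<bullet> \<gamma> \<le> long_sq"
  unfolding long_sq_def using finite_roots by (intro Max_ge) auto

lemma ex_long_root: obtains \<gamma> where "\<gamma> \<in> \<Phi>" "\<gamma> \<bullet> \<gamma> = long_sq"
proof -
  have "long_sq \<in> (\<lambda>\<gamma>. \<gamma> \<bullet> \<gamma>) ` \<Phi>"
    unfolding long_sq_def using finite_roots roots_nonempty by (intro Max_in) auto
  then show ?thesis using that by auto
qed

lemma long_root_iff: "long_root \<Phi> \<gamma> \<longleftrightarrow> \<gamma> \<in> \<Phi> \<and> \<gamma> \<bullet> \<gamma> = long_sq"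
proof
  assume l: "long_root \<Phi> \<gamma>"
  obtain \<delta> where "\<delta> \<in> \<Phi>" "\<delta> \<bullet> \<delta> = long_sq" by (rule ex_long_root)
  then show "\<gamma> \<in> \<Phi> \<and> \<gamma> \<bullet> \<gamma> = long_sq"
    using l root_sq_le[of \<gamma>] by (force simp: long_root_def)
qed (use root_sq_le in \<open>auto simp: long_root_def\<close>)

lemma long_sq_pos: "long_sq > 0"
  using ex_long_root root_sq_pos by metis

text \<open>The roots of the length of \<open>\<beta>\<close> are permuted by the reflections, so the roots not orthogonal to
  all of them form a component of \<open>\<Phi>\<close>.\<close>

lemma ex_nonorthogonal_root:
  assumes "\<alpha> \<in> \<Phi>" "\<beta> \<in> \<Phi>"
  obtains \<beta>' where "\<beta>' \<in> \<Phi>" "\<beta>' \<bullet> \<beta>' = \<beta> \<bullet> \<beta>" "\<beta>' \<bullet> \<alpha> \<noteq> 0"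
proof (rule ccontr)
  assume no: "\<not> thesis"
  define A where "A = {a \<in> \<Phi>. \<exists>\<epsilon>\<in>\<Phi>. \<epsilon> \<bullet> \<epsilon> = \<beta> \<bullet> \<beta> \<and> \<epsilon> \<bullet> a \<noteq> 0}"
  have "\<beta> \<in> A" using assms root_nonzero by (auto simp: A_def)
  moreover have "\<alpha> \<in> \<Phi> - A" using no that assms by (auto simp: A_def)
  moreover have "a \<bullet> b = 0" if a: "a \<in> A" and b: "b \<in> \<Phi> - A" for a b
  proof -
    obtain \<epsilon> where \<epsilon>: "\<epsilon> \<in> \<Phi>" "\<epsilon> \<bullet> \<epsilon> = \<beta> \<bullet> \<beta>" "\<epsilon> \<bullet> a \<noteq> 0"
      using a by (auto simp: A_def)
    have "a \<in> \<Phi>" using a by (simp add: A_def)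
    \<comment> \<open>\<epsilon> and its reflection in \<open>a\<close> are both orthogonal to
      \<open>b\<close> and differ by a nonzero multiple of \<open>a\<close>.\<close>
    then have "reflection a \<epsilon> \<in> \<Phi>" "reflection a \<epsilon> \<bullet> reflection a \<epsilon> = \<beta> \<bullet> \<beta>"
      using \<epsilon> by (simp_all add: reflection_root)
    then have "reflection a \<epsilon> \<bullet> b = 0" "\<epsilon> \<bullet> b = 0"
      using b \<epsilon> by (auto simp: A_def)
    then show ?thesis using \<epsilon> root_sq_pos[OF \<open>a \<in> \<Phi>\<close>] by (simp add: inner_reflection)
  qed
  moreover have "A \<union> (\<Phi> - A) = \<Phi>" "A \<inter> (\<Phi> - A) = {}" by (auto simp: A_def)
  ultimately have "\<exists>A B. A \<noteq> {} \<and> B \<noteq> {} \<and> A \<inter> B = {} \<and> A \<union> B = \<Phi> \<and> (\<forall>a\<in>A. \<forall>b\<in>B. a \<bullet> b = 0)"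
    by (intro exI[of _ A] exI[of _ "\<Phi> - A"] conjI ballI) auto
  then show False using irreducible by (simp only: irreducible_root_system_def) simp
qed

text \<open>The Cartan number relative to the longer root is a nonzero integer of absolute value at
  most 1.\<close>

lemma inner_of_shorter_root:
  assumes "\<alpha> \<in> \<Phi>" "\<beta> \<in> \<Phi>" "\<alpha> \<bullet> \<alpha> < \<beta> \<bullet> \<beta>" "\<beta> \<bullet> \<alpha> \<noteq> 0"
  shows "\<bar>\<beta> \<bullet> \<alpha>\<bar> = \<beta> \<bullet> \<beta> / 2"
proof -
  obtain k :: int where k: "2 * (\<alpha> \<bullet> \<beta>) / (\<beta> \<bullet> \<beta>) = of_int k"
    using cartan_integer[OF assms(2,1)] by (elim Ints_cases)
  have pos: "\<beta> \<bullet> \<beta> > 0" using assms(2) by (rule root_sq_pos)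
  have "\<bar>2 * (\<alpha> \<bullet> \<beta>) / (\<beta> \<bullet> \<beta>)\<bar> \<le> 1"
    by (rule abs_cartan_le_1) (use assms root_nonzero cartan_integer in auto)
  then have "\<bar>k\<bar> \<le> 1" unfolding k by linarith
  moreover have "k \<noteq> 0" using k assms pos by (auto simp: inner_commute)
  ultimately have "\<bar>k\<bar> = 1" by linarith
  then have "\<bar>2 * (\<alpha> \<bullet> \<beta>) / (\<beta> \<bullet> \<beta>)\<bar> = 1" unfolding k by linarith
  then show ?thesis using pos by (simp add: inner_commute abs_mult field_simps)
qed

text \<open>Once \<beta> is replaced by a root of the same length not orthogonal to \<alpha>, the
  ratio is the absolute value of the Cartan number of that root relative to \<alpha>.\<close>

lemma root_sq_ratio:
  assumes "\<alpha> \<in> \<Phi>" "\<beta> \<in> \<Phi>" "\<alpha> \<bullet> \<alpha> < \<beta> \<bullet> \<beta>"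
  obtains k :: int where "\<beta> \<bullet> \<beta> = of_int k * (\<alpha> \<bullet> \<alpha>)" "2 \<le> k" "k < 4"
proof -
  obtain \<beta>' where \<beta>': "\<beta>' \<in> \<Phi>" "\<beta>' \<bullet> \<beta>' = \<beta> \<bullet> \<beta>" "\<beta>' \<bullet> \<alpha> \<noteq> 0"
    using ex_nonorthogonal_root assms by blast
  have pos: "\<alpha> \<bullet> \<alpha> > 0" using assms(1) by (rule root_sq_pos)
  have h: "\<bar>\<beta>' \<bullet> \<alpha>\<bar> = \<beta> \<bullet> \<beta> / 2"
    using inner_of_shorter_root[of \<alpha> \<beta>'] \<beta>' assms by simp
  obtain j :: int where j: "2 * (\<beta>' \<bullet> \<alpha>) / (\<alpha> \<bullet> \<alpha>) = of_int j"
    using cartan_integer[OF assms(1) \<beta>'(1)] by (elim Ints_cases)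
  have "2 * (\<beta>' \<bullet> \<alpha>) = of_int j * (\<alpha> \<bullet> \<alpha>)" using j pos by (simp add: field_simps)
  then have "2 * \<bar>\<beta>' \<bullet> \<alpha>\<bar> = of_int \<bar>j\<bar> * (\<alpha> \<bullet> \<alpha>)"
    using pos by (metis abs_mult abs_numeral abs_of_pos of_int_abs)
  then have k: "\<beta> \<bullet> \<beta> = of_int \<bar>j\<bar> * (\<alpha> \<bullet> \<alpha>)" using h by simp
  have "of_int \<bar>j\<bar> > (1::real)"
    using assms(3) pos unfolding k by simp
  then have "2 \<le> \<bar>j\<bar>" by linarith
  moreover have "\<bar>j\<bar> < 4"
  proof -
    \<comment> \<open>The sign \<open>s\<close> turns twice \<alpha> to the side of
      \<open>\<beta>'\<close>. Reducedness keeps the two vectors distinct, and the positive square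
      norm of their difference excludes the ratio 4.\<close>
    define s :: real where "s = sgn (\<beta>' \<bullet> \<alpha>)"
    have s: "s * (\<beta>' \<bullet> \<alpha>) = \<beta> \<bullet> \<beta> / 2" "s * s = 1" "2 * s \<noteq> 1" "2 * s \<noteq> -1"
      using \<beta>'(3) h by (auto simp: s_def sgn_if)
    have "\<beta>' \<noteq> (2 * s) *\<^sub>R \<alpha>" using root_multiple[of \<alpha> "2 * s"] s assms \<beta>' by auto
    then have "0 < (\<beta>' - (2 * s) *\<^sub>R \<alpha>) \<bullet> (\<beta>' - (2 * s) *\<^sub>R \<alpha>)" by simp
    also have "\<dots> = \<beta>' \<bullet> \<beta>' - 4 * (s * (\<beta>' \<bullet> \<alpha>)) + 4 * (s * s) * (\<alpha> \<bullet> \<alpha>)"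
      by (simp add: inner_diff_left inner_diff_right inner_commute algebra_simps)
    also have "\<dots> = 4 * (\<alpha> \<bullet> \<alpha>) - \<beta> \<bullet> \<beta>" using s \<beta>' by simp
    finally have "of_int \<bar>j\<bar> < (4::real)" using pos unfolding k by simp
    then show ?thesis by linarith
  qed
  ultimately show ?thesis using that k by blast
qed

text \<open>A third length would give two successive ratios of at least 2, whose product contradicts
  the bound \<open>k < 4\<close> for the longest against the shortest.\<close>

lemma short_sq_eq:
  assumes "\<alpha> \<in> \<Phi>" "\<beta> \<in> \<Phi>" "\<alpha> \<bullet> \<alpha> \<noteq> long_sq" "\<beta> \<bullet> \<beta> \<noteq> long_sq"
  shows "\<alpha> \<bullet> \<alpha> = \<beta> \<bullet> \<beta>"
proof -
  have False if ab: "\<alpha> \<in> \<Phi>" "\<beta> \<in> \<Phi>" "\<beta> \<bullet> \<beta> \<noteq> long_sq" "\<alpha> \<bullet> \<alpha> < \<beta> \<bullet> \<beta>" for \<alpha> \<beta>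
  proof -
    obtain \<gamma> where \<gamma>: "\<gamma> \<in> \<Phi>" "\<gamma> \<bullet> \<gamma> = long_sq" by (rule ex_long_root)
    have "\<beta> \<bullet> \<beta> < \<gamma> \<bullet> \<gamma>" using ab \<gamma> root_sq_le by fastforce
    obtain i :: int where i: "\<beta> \<bullet> \<beta> = of_int i * (\<alpha> \<bullet> \<alpha>)" "2 \<le> i"
      using root_sq_ratio[of \<alpha> \<beta>] ab by metis
    obtain j :: int where j: "\<gamma> \<bullet> \<gamma> = of_int j * (\<beta> \<bullet> \<beta>)" "2 \<le> j"
      using root_sq_ratio[of \<beta> \<gamma>] ab \<gamma> \<open>\<beta> \<bullet> \<beta> < \<gamma> \<bullet> \<gamma>\<close> by metis
    obtain k :: int where k: "\<gamma> \<bullet> \<gamma> = of_int k * (\<alpha> \<bullet> \<alpha>)" "k < 4"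
      using root_sq_ratio[of \<alpha> \<gamma>] ab \<gamma> \<open>\<beta> \<bullet> \<beta> < \<gamma> \<bullet> \<gamma>\<close> by (metis less_trans)
    have "of_int k = (of_int (j * i) :: real)"
      using i j k root_sq_pos[OF ab(1)] by simp
    moreover have "j * i \<ge> 2 * 2" using i j by (intro mult_mono) auto
    ultimately show False using k by linarith
  qed
  from this[of \<alpha> \<beta>] this[of \<beta> \<alpha>] show ?thesis using assms by (meson linorder_neqE)
qed

lemma long_ratio_int: "\<alpha> \<in> \<Phi> \<Longrightarrow> long_sq / (\<alpha> \<bullet> \<alpha>) \<in> \<int>"
proof (cases "\<alpha> \<bullet> \<alpha> = long_sq")
  case True
  then show ?thesis using long_sq_pos by simp
next
  case False
  assume a: "\<alpha> \<in> \<Phi>"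
  obtain \<gamma> where \<gamma>: "\<gamma> \<in> \<Phi>" "\<gamma> \<bullet> \<gamma> = long_sq" by (rule ex_long_root)
  obtain k :: int where "\<gamma> \<bullet> \<gamma> = of_int k * (\<alpha> \<bullet> \<alpha>)"
    using root_sq_ratio[of \<alpha> \<gamma>] a \<gamma> False root_sq_le[of \<alpha>] by (metis less_le)
  then show ?thesis using root_sq_pos[OF a] \<gamma> by simp
qed

lemma long_ge_twice_short:
  assumes "\<alpha> \<in> \<Phi>" "\<alpha> \<bullet> \<alpha> \<noteq> long_sq"
  shows "2 * (\<alpha> \<bullet> \<alpha>) \<le> long_sq"
proof -
  obtain \<gamma> where \<gamma>: "\<gamma> \<in> \<Phi>" "\<gamma> \<bullet> \<gamma> = long_sq" by (rule ex_long_root)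
  obtain k :: int where "\<gamma> \<bullet> \<gamma> = of_int k * (\<alpha> \<bullet> \<alpha>)" "2 \<le> k"
    using root_sq_ratio[of \<alpha> \<gamma>] \<gamma> assms root_sq_le[of \<alpha>] by (metis less_le)
  then show ?thesis using \<gamma> by (metis inner_ge_zero mult_right_mono of_int_le_iff of_int_numeral)
qed

text \<open>Short roots share one length by \<open>short_sq_eq\<close>, so every short \<alpha>
  attains the smallest denominator.\<close>

lemma lacing_number_eq:
  assumes "\<alpha> \<in> \<Phi>" "\<alpha> \<bullet> \<alpha> \<noteq> long_sq"
  shows "lacing_number \<Phi> = long_sq / (\<alpha> \<bullet> \<alpha>)"
  unfolding lacing_number_def
proof (rule Max_eqI)
  have "{\<alpha> \<bullet> \<alpha> / (\<beta> \<bullet> \<beta>) |\<alpha> \<beta>. \<alpha> \<in> \<Phi> \<and> \<beta> \<in> \<Phi>} = (\<lambda>(\<alpha>, \<beta>). \<alpha> \<bullet> \<alpha> / (\<beta> \<bullet> \<beta>)) ` (\<Phi> \<times> \<Phi>)"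
    by auto
  then show "finite {\<alpha> \<bullet> \<alpha> / (\<beta> \<bullet> \<beta>) |\<alpha> \<beta>. \<alpha> \<in> \<Phi> \<and> \<beta> \<in> \<Phi>}"
    using finite_roots by simp
next
  fix y assume "y \<in> {\<alpha> \<bullet> \<alpha> / (\<beta> \<bullet> \<beta>) |\<alpha> \<beta>. \<alpha> \<in> \<Phi> \<and> \<beta> \<in> \<Phi>}"
  then obtain \<gamma> \<delta> where y: "y = \<gamma> \<bullet> \<gamma> / (\<delta> \<bullet> \<delta>)" "\<gamma> \<in> \<Phi>" "\<delta> \<in> \<Phi>" by blast
  have "\<alpha> \<bullet> \<alpha> \<le> \<delta> \<bullet> \<delta>"
    using short_sq_eq[of \<alpha> \<delta>] assms y root_sq_le[of \<alpha>] by fastforce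
  then show "y \<le> long_sq / (\<alpha> \<bullet> \<alpha>)"
    unfolding y using root_sq_le[OF y(2)] root_sq_pos[OF assms(1)] long_sq_pos by (intro frac_le) auto
next
  obtain \<gamma> where "\<gamma> \<in> \<Phi>" "\<gamma> \<bullet> \<gamma> = long_sq" by (rule ex_long_root)
  then show "long_sq / (\<alpha> \<bullet> \<alpha>) \<in> {\<alpha> \<bullet> \<alpha> / (\<beta> \<bullet> \<beta>) |\<alpha> \<beta>. \<alpha> \<in> \<Phi> \<and> \<beta> \<in> \<Phi>}"
    using assms(1) by (intro CollectI exI[of _ \<gamma>] exI[of _ \<alpha>]) simp
qed

section \<open>The lattice spanned by the long roots\<close>

text \<open>In terms of the simple roots this lattice is spanned by the long ones and by the short ones
  multiplied by the lacing number.  Rescaled, it is the coroot lattice, since a long root \<open>\<gamma>\<close> has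
  coroot \<open>2 \<gamma> / long_sq\<close>.\<close>

definition long_lattice :: "'a set" where
  "long_lattice = {v \<in> span \<Delta>. \<forall>\<alpha>\<in>\<Delta>. coeff v \<alpha> * (\<alpha> \<bullet> \<alpha>) / long_sq \<in> \<int>}"

text \<open>The expression is the coefficient of the coroot of \<gamma> at the coroot of \<alpha>:
  coroots are integral combinations of simple coroots. A simple reflection changes only one of these
  coefficients, by a Cartan integer.\<close>

lemma coroot_coeff_int:
  assumes "\<gamma> \<in> \<Phi>" "\<alpha> \<in> \<Delta>"
  shows "coeff \<gamma> \<alpha> * (\<alpha> \<bullet> \<alpha>) / (\<gamma> \<bullet> \<gamma>) \<in> \<int>"
  using assms
proof (induction arbitrary: \<alpha> rule: root_induct)
  case (simple \<delta>)
  then show ?case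
    using root_sq_pos[OF simple_root] by (simp add: coeff_simple)
next
  case (reflection \<delta> \<gamma>)
  have pos: "\<delta> \<bullet> \<delta> > 0" "\<gamma> \<bullet> \<gamma> > 0" using reflection by (blast intro: root_sq_pos simple_root)+
  have "coeff (reflection \<delta> \<gamma>) \<delta> * (\<delta> \<bullet> \<delta>) / (\<gamma> \<bullet> \<gamma>) =
      coeff \<gamma> \<delta> * (\<delta> \<bullet> \<delta>) / (\<gamma> \<bullet> \<gamma>) - 2 * (\<delta> \<bullet> \<gamma>) / (\<gamma> \<bullet> \<gamma>)"
    using pos reflection root_span by (simp add: coeff_reflection field_simps inner_commute)
  moreover have "2 * (\<delta> \<bullet> \<gamma>) / (\<gamma> \<bullet> \<gamma>) \<in> \<int>" using reflection by (simp add: cartan_integer simple_root)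
  ultimately have "coeff (reflection \<delta> \<gamma>) \<delta> * (\<delta> \<bullet> \<delta>) / (\<gamma> \<bullet> \<gamma>) \<in> \<int>"
    using reflection by simp
  then show ?case
    using reflection by (cases "\<alpha> = \<delta>") (simp_all add: coeff_reflection root_span)
qed

lemma long_lattice_span: "v \<in> long_lattice \<Longrightarrow> v \<in> span \<Delta>"
  by (simp add: long_lattice_def)

lemma long_lattice_int: "v \<in> long_lattice \<Longrightarrow> \<alpha> \<in> \<Delta> \<Longrightarrow> coeff v \<alpha> * (\<alpha> \<bullet> \<alpha>) / long_sq \<in> \<int>"
  by (simp add: long_lattice_def)

lemma long_lattice_coeff_int:
  assumes "v \<in> long_lattice" "\<alpha> \<in> \<Delta>"
  shows "coeff v \<alpha> \<in> \<int>"
proof -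
  have "coeff v \<alpha> = (coeff v \<alpha> * (\<alpha> \<bullet> \<alpha>) / long_sq) * (long_sq / (\<alpha> \<bullet> \<alpha>))"
    using long_sq_pos root_sq_pos[OF simple_root[OF assms(2)]] by simp
  then show ?thesis
    using Ints_mult[OF long_lattice_int[OF assms] long_ratio_int[OF simple_root[OF assms(2)]]] by simp
qed

text \<open>Up to the factor \<open>long_sq / 2\<close>, \<open>v\<close> is an integral combination
  of simple coroots, which pair integrally with roots.\<close>

lemma long_lattice_cartan:
  assumes "v \<in> long_lattice" "\<alpha> \<in> \<Phi>"
  shows "2 * (v \<bullet> \<alpha>) / long_sq \<in> \<int>"
proof -
  have "2 * (v \<bullet> \<alpha>) / long_sq =
      (\<Sum>\<delta>\<in>\<Delta>. (coeff v \<delta> * (\<delta> \<bullet> \<delta>) / long_sq) * (2 * (\<alpha> \<bullet> \<delta>) / (\<delta> \<bullet> \<delta>)))"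
    unfolding inner_coeff[OF long_lattice_span[OF assms(1)]] sum_distrib_left sum_divide_distrib
    by (rule sum.cong) (use root_nonzero simple_root in \<open>auto simp: inner_commute\<close>)
  also have "\<dots> \<in> \<int>"
    using assms by (intro Ints_sum Ints_mult long_lattice_int cartan_integer) (auto intro: simple_root)
  finally show ?thesis .
qed

lemma long_lattice_diff: "v \<in> long_lattice \<Longrightarrow> w \<in> long_lattice \<Longrightarrow> v - w \<in> long_lattice"
  by (auto simp: long_lattice_def span_diff coeff_diff left_diff_distrib diff_divide_distrib)

text \<open>Only the coefficient at \<alpha> moves; after rescaling, its change is the integer of
  \<open>long_lattice_cartan\<close>.\<close>

lemma long_lattice_reflection:
  assumes "v \<in> long_lattice" "\<alpha> \<in> \<Delta>"
  shows "reflection \<alpha> v \<in> long_lattice"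
proof -
  have "coeff (reflection \<alpha> v) \<alpha> * (\<alpha> \<bullet> \<alpha>) / long_sq =
      coeff v \<alpha> * (\<alpha> \<bullet> \<alpha>) / long_sq - 2 * (v \<bullet> \<alpha>) / long_sq"
    using assms root_sq_pos[OF simple_root[OF assms(2)]]
    by (simp add: coeff_reflection long_lattice_span left_diff_distrib diff_divide_distrib)
  also have "\<dots> \<in> \<int>"
    using assms by (intro Ints_diff long_lattice_int long_lattice_cartan simple_root)
  finally have "coeff (reflection \<alpha> v) \<alpha> * (\<alpha> \<bullet> \<alpha>) / long_sq \<in> \<int>" .
  moreover have "coeff (reflection \<alpha> v) \<delta> * (\<delta> \<bullet> \<delta>) / long_sq \<in> \<int>" if "\<delta> \<in> \<Delta>" "\<delta> \<noteq> \<alpha>" for \<delta>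
    using that assms by (simp add: coeff_reflection long_lattice_span long_lattice_int)
  ultimately show ?thesis
    using assms by (auto simp: long_lattice_def reflection_span)
qed

text \<open>Adding one simple root at a time collects each mixed term with the factor 2 that makes
  it a Cartan integer.\<close>

lemma long_lattice_norm:
  assumes v: "v \<in> long_lattice"
  shows "v \<bullet> v / long_sq \<in> \<int>"
proof -
  have square: "(x + y) \<bullet> (x + y) = x \<bullet> x + 2 * (x \<bullet> y) + y \<bullet> y" for x y :: 'a
    by (simp add: inner_add_left inner_add_right inner_commute)
  have "(\<Sum>\<alpha>\<in>T. coeff v \<alpha> *\<^sub>R \<alpha>) \<bullet> (\<Sum>\<alpha>\<in>T. coeff v \<alpha> *\<^sub>R \<alpha>) / long_sq \<in> \<int>" if "T \<subseteq> \<Delta>" for T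
    using finite_subset[OF that finite_simple] that
  proof (induction T rule: finite_induct)
    case (insert a T)
    let ?x = "\<Sum>\<alpha>\<in>T. coeff v \<alpha> *\<^sub>R \<alpha>" and ?n = "coeff v a * (a \<bullet> a) / long_sq"
    have a: "a \<in> \<Delta>" "a \<bullet> a > 0" using insert.prems by (blast intro: root_sq_pos simple_root)+
    have n: "?n \<in> \<int>" using v a by (simp add: long_lattice_int)
    \<comment> \<open>The integer \<open>?n\<close> absorbs the division by \<open>long_sq\<close>,
      so that integrality of the other factor suffices here and in the mixed term.\<close>
    have "coeff v a *\<^sub>R a \<bullet> (coeff v a *\<^sub>R a) / long_sq = ?n * coeff v a" by simp
    also have "\<dots> \<in> \<int>" using n long_lattice_coeff_int[OF v a(1)] by (rule Ints_mult)
    finally have 1: "coeff v a *\<^sub>R a \<bullet> (coeff v a *\<^sub>R a) / long_sq \<in> \<int>" .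
    have "2 * (coeff v a *\<^sub>R a \<bullet> ?x) / long_sq =
        ?n * (\<Sum>\<delta>\<in>T. coeff v \<delta> * (2 * (\<delta> \<bullet> a) / (a \<bullet> a)))"
      using a by (simp add: inner_sum_right sum_distrib_left sum_divide_distrib inner_commute mult_ac)
    also have "\<dots> \<in> \<int>"
      using n v a insert.prems
      by (intro Ints_mult Ints_sum long_lattice_coeff_int cartan_integer simple_root) auto
    finally have 2: "2 * (coeff v a *\<^sub>R a \<bullet> ?x) / long_sq \<in> \<int>" .
    have 3: "?x \<bullet> ?x / long_sq \<in> \<int>" using insert by simp
    have "(coeff v a *\<^sub>R a + ?x) \<bullet> (coeff v a *\<^sub>R a + ?x) / long_sq =
        coeff v a *\<^sub>R a \<bullet> (coeff v a *\<^sub>R a) / long_sq + 2 * (coeff v a *\<^sub>R a \<bullet> ?x) / long_sq + ?x \<bullet> ?x / long_sq"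
      by (simp only: square add_divide_distrib)
    also have "\<dots> \<in> \<int>" using 1 2 3 by (intro Ints_add)
    finally show ?case using insert.hyps by simp
  qed simp
  from this[of \<Delta>] show ?thesis using v by (simp add: sum_coeff long_lattice_span)
qed

text \<open>Descent in \<open>size_coeffs\<close>: simple reflections preserve the lattice and the
  norm, and a suitable one decreases the size unless \<open>v\<close> is plus or minus a simple
  root.\<close>

lemma long_lattice_root:
  assumes "v \<in> long_lattice" "v \<bullet> v = long_sq"
  shows "v \<in> \<Phi>"
  using assms
proof (induction "size_coeffs v" arbitrary: v rule: less_induct)
  case less
  note v = less.prems
  have span: "v \<in> span \<Delta>" "v \<noteq> 0" using v long_sq_pos by (auto simp: long_lattice_span)
  obtain \<alpha> where \<alpha>: "\<alpha> \<in> \<Delta>" "coeff v \<alpha> * (v \<bullet> \<alpha>) > 0"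
    using ex_coeff_inner_pos[OF span] by blast
  have r: "\<alpha> \<in> \<Phi>" and pos: "\<alpha> \<bullet> \<alpha> > 0" using \<alpha> by (blast intro: root_sq_pos simple_root)+
  show ?case
  proof (cases "v = \<alpha> \<or> v = - \<alpha>")
    case True
    then show ?thesis using r minus_root by auto
  next
    case False
    \<comment> \<open>Here \<open>k\<close> is the Cartan number of \<alpha> relative to
      \<open>v\<close>, \<open>j\<close> the rescaled coefficient and \<open>q\<close> the length
      ratio: the coefficient at \<alpha> is \<open>j * q\<close>, and the reflection subtracts
      \<open>k * q\<close>.\<close>
    obtain k :: int where k: "2 * (v \<bullet> \<alpha>) / long_sq = of_int k"
      using long_lattice_cartan[OF v(1) r] by (elim Ints_cases)
    obtain j :: int where j: "coeff v \<alpha> * (\<alpha> \<bullet> \<alpha>) / long_sq = of_int j"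
      using long_lattice_int[OF v(1) \<alpha>(1)] by (elim Ints_cases)
    obtain q :: int where q: "long_sq / (\<alpha> \<bullet> \<alpha>) = of_int q"
      using long_ratio_int[OF r] by (elim Ints_cases)
    have qpos: "q > 0" using q pos long_sq_pos by (metis divide_pos_pos of_int_0_less_iff)
    have kk: "2 * (\<alpha> \<bullet> v) / (v \<bullet> v) = of_int k" using k v(2) by (simp add: inner_commute)
    have "\<bar>2 * (\<alpha> \<bullet> v) / (v \<bullet> v)\<bar> \<le> 1"
      by (rule abs_cartan_le_1) (use False root_sq_le[OF r] v span kk in auto)
    then have "\<bar>k\<bar> \<le> 1" unfolding kk by linarith
    have cj: "coeff v \<alpha> = of_int (j * q)" using j q pos long_sq_pos by (simp add: field_simps)
    have mk: "2 * (v \<bullet> \<alpha>) / (\<alpha> \<bullet> \<alpha>) = of_int (k * q)"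
      using k q pos long_sq_pos by (simp add: field_simps)
    have "coeff v \<alpha> * (2 * (v \<bullet> \<alpha>) / (\<alpha> \<bullet> \<alpha>)) > 0"
      using \<alpha>(2) pos by (simp add: zero_less_mult_iff zero_less_divide_iff divide_less_0_iff)
    then have "(j * q) * (k * q) > 0" unfolding cj mk by (metis of_int_0_less_iff of_int_mult)
    then have jk: "j * k > 0" using qpos by (simp add: zero_less_mult_iff mult_less_0_iff)
    \<comment> \<open>As \<open>k\<close> is 1 or -1 with the sign of \<open>j\<close>, subtracting
      it moves \<open>j\<close> one step closer to zero.\<close>
    have "\<bar>j - k\<bar> < \<bar>j\<bar>"
      using jk \<open>\<bar>k\<bar> \<le> 1\<close> by (auto simp: zero_less_mult_iff)
    then have "\<bar>j - k\<bar> * q < \<bar>j\<bar> * q" using qpos by simp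
    then have "\<bar>j * q - k * q\<bar> < \<bar>j * q\<bar>"
      using qpos by (simp add: abs_mult flip: left_diff_distrib)
    then have "\<bar>coeff v \<alpha> - 2 * (v \<bullet> \<alpha>) / (\<alpha> \<bullet> \<alpha>)\<bar> < \<bar>coeff v \<alpha>\<bar>"
      unfolding cj mk by linarith
    then have "size_coeffs (reflection \<alpha> v) < size_coeffs v"
      by (intro size_reflection_less \<alpha> span) (simp_all add: cj mk)
    from less.hyps[OF this] have "reflection \<alpha> v \<in> \<Phi>"
      using v \<alpha> by (simp add: long_lattice_reflection)
    then show ?thesis using reflection_root[OF r, of "reflection \<alpha> v"] by simp
  qed
qed

section \<open>Short roots supported on short simple roots\<close>

text \<open>Two short roots \<open>\<gamma>\<close>, \<open>\<alpha>\<^sub>0\<close> that both form an obtuse angle with the long root \<open>\<delta>\<close> cannot be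
  orthogonal, as otherwise \<open>\<delta> + \<gamma> + \<alpha>\<^sub>0\<close> would have nonpositive square norm.  Hence \<open>\<gamma> - \<alpha>\<^sub>0\<close> is a
  root, and one may replace \<open>\<gamma>\<close> and \<open>\<delta>\<close> by their reflections in \<open>\<alpha>\<^sub>0\<close>.\<close>

lemma short_coeff_le_1_aux:
  assumes "T \<subseteq> \<Delta>" "\<And>\<alpha>. \<alpha> \<in> T \<Longrightarrow> \<alpha> \<bullet> \<alpha> \<noteq> long_sq"
    and "\<delta> \<in> \<Phi>" "\<delta> \<bullet> \<delta> = long_sq" "\<exists>\<alpha>\<in>\<Delta> - T. coeff \<delta> \<alpha> \<noteq> 0"
    and "\<And>\<alpha>. \<alpha> \<in> T \<Longrightarrow> \<delta> \<bullet> \<alpha> \<le> 0"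
    and "\<gamma> \<in> \<Phi>" "\<gamma> \<bullet> \<gamma> \<noteq> long_sq" "\<And>\<alpha>. \<alpha> \<in> \<Delta> - T \<Longrightarrow> coeff \<gamma> \<alpha> = 0"
    and "\<And>\<alpha>. \<alpha> \<in> \<Delta> \<Longrightarrow> 0 \<le> coeff \<gamma> \<alpha>"
    and "\<delta> \<bullet> \<gamma> < 0" "\<alpha> \<in> \<Delta>"
  shows "coeff \<gamma> \<alpha> \<le> 1"
  using finite_subset[OF assms(1) finite_simple] assms
proof (induction T arbitrary: \<gamma> \<delta> \<alpha> rule: finite_psubset_induct)
  case (psubset T)
  note T = psubset.prems(1,2) and \<delta> = psubset.prems(3,4) and \<delta>T = psubset.prems(5)
    and obtuse = psubset.prems(6) and \<gamma> = psubset.prems(7,8) and \<gamma>T = psubset.prems(9)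
    and nonneg = psubset.prems(10) and neg = psubset.prems(11)
  have short_inner: "\<delta> \<bullet> \<epsilon> = - (long_sq / 2)" if "\<epsilon> \<in> \<Phi>" "\<epsilon> \<bullet> \<epsilon> \<noteq> long_sq" "\<delta> \<bullet> \<epsilon> < 0" for \<epsilon>
    using inner_of_shorter_root[of \<epsilon> \<delta>] that \<delta> root_sq_le[of \<epsilon>] by fastforce
  have \<delta>\<gamma>: "\<delta> \<bullet> \<gamma> = - (long_sq / 2)" using short_inner \<gamma> neg by blast
  have sum: "(\<Sum>\<alpha>\<in>T. coeff \<gamma> \<alpha> * (\<alpha> \<bullet> \<delta>)) = - (long_sq / 2)"
  proof -
    have "(\<Sum>\<alpha>\<in>T. coeff \<gamma> \<alpha> * (\<alpha> \<bullet> \<delta>)) = (\<Sum>\<alpha>\<in>\<Delta>. coeff \<gamma> \<alpha> * (\<alpha> \<bullet> \<delta>))"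
      using T(1) \<gamma>T finite_simple by (intro sum.mono_neutral_left) auto
    then show ?thesis using \<delta>\<gamma> inner_coeff[OF root_span[OF \<gamma>(1)], of \<delta>] by (simp add: inner_commute)
  qed
  have nonpos: "coeff \<gamma> \<alpha> * (\<alpha> \<bullet> \<delta>) \<le> 0" if "\<alpha> \<in> T" for \<alpha>
    using obtuse[OF that] nonneg[of \<alpha>] that T(1) by (auto simp: inner_commute mult_nonneg_nonpos)
  \<comment> \<open>The summands are nonpositive with negative total, so one of them is
    negative.\<close>
  obtain \<alpha>\<^sub>0 where \<alpha>\<^sub>0: "\<alpha>\<^sub>0 \<in> T" "coeff \<gamma> \<alpha>\<^sub>0 * (\<alpha>\<^sub>0 \<bullet> \<delta>) < 0"
    using sum long_sq_pos sum_nonneg[of T "\<lambda>\<alpha>. coeff \<gamma> \<alpha> * (\<alpha> \<bullet> \<delta>)"] by (force simp: not_le)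
  have \<alpha>\<^sub>0\<Delta>: "\<alpha>\<^sub>0 \<in> \<Delta>" "\<alpha>\<^sub>0 \<in> \<Phi>" using \<alpha>\<^sub>0 T simple_root by auto
  have pos: "\<alpha>\<^sub>0 \<bullet> \<alpha>\<^sub>0 > 0" using \<alpha>\<^sub>0\<Delta> by (blast intro: root_sq_pos)
  have \<delta>\<alpha>\<^sub>0: "\<delta> \<bullet> \<alpha>\<^sub>0 = - (long_sq / 2)"
    using short_inner[OF \<alpha>\<^sub>0\<Delta>(2) T(2)[OF \<alpha>\<^sub>0(1)]] \<alpha>\<^sub>0 obtuse[OF \<alpha>\<^sub>0(1)] by (force simp: inner_commute)
  \<comment> \<open>One copy of \<open>\<alpha>\<^sub>0\<close> already contributes the whole total,
    which leaves no room for a second.\<close>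
  have c1: "coeff \<gamma> \<alpha>\<^sub>0 = 1"
  proof -
    have "- (long_sq / 2) \<le> coeff \<gamma> \<alpha>\<^sub>0 * (\<alpha>\<^sub>0 \<bullet> \<delta>)"
    proof -
      have "(\<Sum>\<alpha>\<in>T. coeff \<gamma> \<alpha> * (\<alpha> \<bullet> \<delta>)) =
          coeff \<gamma> \<alpha>\<^sub>0 * (\<alpha>\<^sub>0 \<bullet> \<delta>) + (\<Sum>\<alpha>\<in>T - {\<alpha>\<^sub>0}. coeff \<gamma> \<alpha> * (\<alpha> \<bullet> \<delta>))"
        using psubset.hyps \<alpha>\<^sub>0 by (intro sum.remove) auto
      moreover have "(\<Sum>\<alpha>\<in>T - {\<alpha>\<^sub>0}. coeff \<gamma> \<alpha> * (\<alpha> \<bullet> \<delta>)) \<le> 0"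
        using nonpos by (intro sum_nonpos) auto
      ultimately show ?thesis using sum by linarith
    qed
    then have le: "coeff \<gamma> \<alpha>\<^sub>0 \<le> 1"
      using \<delta>\<alpha>\<^sub>0 long_sq_pos by (simp add: inner_commute)
    obtain i :: int where i: "coeff \<gamma> \<alpha>\<^sub>0 = of_int i"
      using coeff_int[OF \<gamma>(1) \<alpha>\<^sub>0\<Delta>(1)] by (elim Ints_cases)
    have "coeff \<gamma> \<alpha>\<^sub>0 > 0" using \<alpha>\<^sub>0(2) nonneg[OF \<alpha>\<^sub>0\<Delta>(1)] by (cases "coeff \<gamma> \<alpha>\<^sub>0 = 0") auto
    with le have "i = 1" unfolding i by linarith
    then show ?thesis using i by simp
  qed
  show ?case
  proof (cases "\<gamma> = \<alpha>\<^sub>0")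
    case True
    then show ?thesis using \<alpha>\<^sub>0\<Delta> by (simp add: coeff_simple)
  next
    case False
    have sq: "\<gamma> \<bullet> \<gamma> = \<alpha>\<^sub>0 \<bullet> \<alpha>\<^sub>0" using short_sq_eq \<gamma> \<alpha>\<^sub>0\<Delta> T(2) \<alpha>\<^sub>0 by blast
    have twice: "2 * (\<alpha>\<^sub>0 \<bullet> \<alpha>\<^sub>0) \<le> long_sq" using long_ge_twice_short \<alpha>\<^sub>0\<Delta> T(2) \<alpha>\<^sub>0 by blast
    \<comment> \<open>Outside \<open>T\<close> the coefficients of \<gamma> and
      \<open>\<alpha>\<^sub>0\<close> are 0, but those of \<delta> are not all 0.\<close>
    have "\<delta> + \<gamma> + \<alpha>\<^sub>0 \<noteq> 0"
    proof
      assume "\<delta> + \<gamma> + \<alpha>\<^sub>0 = 0"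
      then have "\<delta> = - \<gamma> - \<alpha>\<^sub>0" by (simp add: algebra_simps eq_neg_iff_add_eq_0)
      then have "coeff \<delta> \<epsilon> = - coeff \<gamma> \<epsilon> - coeff \<alpha>\<^sub>0 \<epsilon>" for \<epsilon>
        using \<gamma> \<alpha>\<^sub>0\<Delta> by (simp add: coeff_diff coeff_uminus root_span span_neg)
      then have "coeff \<delta> \<epsilon> = 0" if "\<epsilon> \<in> \<Delta> - T" for \<epsilon>
        using that \<gamma>T \<alpha>\<^sub>0 \<alpha>\<^sub>0\<Delta> by (auto simp: coeff_simple)
      then show False using \<delta>T by blast
    qed
    then have "0 < (\<delta> + \<gamma> + \<alpha>\<^sub>0) \<bullet> (\<delta> + \<gamma> + \<alpha>\<^sub>0)" by simp
    also have "\<dots> = 2 * (\<alpha>\<^sub>0 \<bullet> \<alpha>\<^sub>0) - long_sq + 2 * (\<gamma> \<bullet> \<alpha>\<^sub>0)"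
      using \<delta> \<delta>\<gamma> \<delta>\<alpha>\<^sub>0 sq by (simp add: inner_add_left inner_add_right inner_commute)
    finally have gpos: "\<gamma> \<bullet> \<alpha>\<^sub>0 > 0" using twice by linarith
    have cart: "2 * (\<gamma> \<bullet> \<alpha>\<^sub>0) / (\<alpha>\<^sub>0 \<bullet> \<alpha>\<^sub>0) = 1"
    proof -
      obtain k :: int where k: "2 * (\<gamma> \<bullet> \<alpha>\<^sub>0) / (\<alpha>\<^sub>0 \<bullet> \<alpha>\<^sub>0) = of_int k"
        using cartan_integer[OF \<alpha>\<^sub>0\<Delta>(2) \<gamma>(1)] by (elim Ints_cases)
      have "\<gamma> \<noteq> - \<alpha>\<^sub>0" using gpos pos by (metis inner_minus_left neg_less_0_iff_less not_less_iff_gr_or_eq)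
      then have "\<bar>2 * (\<gamma> \<bullet> \<alpha>\<^sub>0) / (\<alpha>\<^sub>0 \<bullet> \<alpha>\<^sub>0)\<bar> \<le> 1"
        by (intro abs_cartan_le_1) (use sq False pos k in auto)
      moreover have "2 * (\<gamma> \<bullet> \<alpha>\<^sub>0) / (\<alpha>\<^sub>0 \<bullet> \<alpha>\<^sub>0) > 0" using gpos pos by simp
      ultimately have "k = 1" unfolding k by linarith
      then show ?thesis unfolding k by simp
    qed
    \<comment> \<open>By \<open>c1\<close> and \<open>cart\<close> the reflection removes
      \<open>\<alpha>\<^sub>0\<close> from the support of \<gamma>, so the induction hypothesis for
      the smaller set applies to the reflected pair.\<close>
    let ?T = "T - {\<alpha>\<^sub>0}" and ?\<delta> = "reflection \<alpha>\<^sub>0 \<delta>" and ?\<gamma> = "reflection \<alpha>\<^sub>0 \<gamma>"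
    have c\<delta>: "coeff ?\<delta> \<epsilon> = coeff \<delta> \<epsilon>" if "\<epsilon> \<noteq> \<alpha>\<^sub>0" for \<epsilon>
      using that \<alpha>\<^sub>0\<Delta> \<delta> by (simp add: coeff_reflection root_span)
    have c\<gamma>: "coeff ?\<gamma> \<epsilon> = (if \<epsilon> = \<alpha>\<^sub>0 then 0 else coeff \<gamma> \<epsilon>)" for \<epsilon>
      using \<alpha>\<^sub>0\<Delta> \<gamma> c1 by (simp add: coeff_reflection root_span cart)
    have le: "coeff ?\<gamma> \<epsilon> \<le> 1" if "\<epsilon> \<in> \<Delta>" for \<epsilon>
    proof (rule psubset.IH[of ?T ?\<delta>])
      show "?T \<subset> T" using \<alpha>\<^sub>0 by blast
      show "\<exists>\<epsilon>\<in>\<Delta> - ?T. coeff ?\<delta> \<epsilon> \<noteq> 0" using \<delta>T c\<delta> \<alpha>\<^sub>0(1) by (metis Diff_iff)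
      show "?\<delta> \<bullet> \<epsilon> \<le> 0" if "\<epsilon> \<in> ?T" for \<epsilon>
      proof -
        \<comment> \<open>The reflection adds a positive multiple of \<open>\<alpha>\<^sub>0\<close>
          to \<delta>, which cannot increase the inner products with the other simple roots.\<close>
        have "\<alpha>\<^sub>0 \<bullet> \<epsilon> \<le> 0" using simple_obtuse[of \<epsilon> \<alpha>\<^sub>0] that T(1) \<alpha>\<^sub>0\<Delta> by blast
        moreover have "2 * (\<delta> \<bullet> \<alpha>\<^sub>0) / (\<alpha>\<^sub>0 \<bullet> \<alpha>\<^sub>0) \<le> 0"
          using \<delta>\<alpha>\<^sub>0 pos long_sq_pos by (simp add: divide_nonpos_pos)
        ultimately have "2 * (\<delta> \<bullet> \<alpha>\<^sub>0) / (\<alpha>\<^sub>0 \<bullet> \<alpha>\<^sub>0) * (\<alpha>\<^sub>0 \<bullet> \<epsilon>) \<ge> 0" by (rule mult_nonpos_nonpos[rotated])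
        then show ?thesis using obtuse[of \<epsilon>] that unfolding inner_reflection by simp
      qed
      show "coeff ?\<gamma> \<epsilon> = 0" if "\<epsilon> \<in> \<Delta> - ?T" for \<epsilon> using that \<gamma>T c\<gamma> by auto
      show "0 \<le> coeff ?\<gamma> \<epsilon>" if "\<epsilon> \<in> \<Delta>" for \<epsilon> using that nonneg c\<gamma> by simp
    qed (use T \<delta> \<gamma> \<alpha>\<^sub>0\<Delta> neg that in \<open>auto intro: reflection_root\<close>)
    show ?thesis
      using le[OF psubset.prems(12)] c1 c\<gamma>[of \<alpha>] by (cases "\<alpha> = \<alpha>\<^sub>0") auto
  qed
qed

text \<open>Simple reflections preserve length, so \<open>root_induct\<close> would spread the
  absence of long simple roots to all of \<open>\<Phi>\<close>.\<close>

lemma ex_long_simple: "\<exists>\<delta>\<in>\<Delta>. \<delta> \<bullet> \<delta> = long_sq"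
proof (rule ccontr)
  assume no: "\<not> ?thesis"
  have "\<gamma> \<bullet> \<gamma> \<noteq> long_sq" if "\<gamma> \<in> \<Phi>" for \<gamma>
    using that by (induction rule: root_induct) (use no in auto)
  then show False using ex_long_root by blast
qed

text \<open>A root of maximal height above \<open>\<gamma>\<close> forms an obtuse angle with some long simple root, since
  otherwise its support would split off as a component of \<open>\<Delta>\<close>.\<close>

lemma short_coeff_le_1_nonneg:
  assumes \<gamma>: "\<gamma> \<in> \<Phi>" "\<gamma> \<bullet> \<gamma> \<noteq> long_sq"
    and supp: "\<And>\<alpha>. \<alpha> \<in> \<Delta> \<Longrightarrow> \<alpha> \<bullet> \<alpha> = long_sq \<Longrightarrow> coeff \<gamma> \<alpha> = 0"
    and nonneg: "\<And>\<alpha>. \<alpha> \<in> \<Delta> \<Longrightarrow> 0 \<le> coeff \<gamma> \<alpha>"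
    and "\<alpha> \<in> \<Delta>"
  shows "coeff \<gamma> \<alpha> \<le> 1"
proof -
  define F where "F = {\<eta> \<in> \<Phi>. \<eta> \<bullet> \<eta> \<noteq> long_sq \<and> (\<forall>\<alpha>\<in>\<Delta>. \<alpha> \<bullet> \<alpha> = long_sq \<longrightarrow> coeff \<eta> \<alpha> = 0) \<and>
    (\<forall>\<alpha>\<in>\<Delta>. coeff \<gamma> \<alpha> \<le> coeff \<eta> \<alpha>)}"
  let ?ht = "\<lambda>\<eta>. \<Sum>\<alpha>\<in>\<Delta>. coeff \<eta> \<alpha>"
  have "finite F" "\<gamma> \<in> F" using finite_roots \<gamma> supp by (auto simp: F_def)
  then have "Max (?ht ` F) \<in> ?ht ` F" by (intro Max_in) auto
  then obtain \<eta> where "\<eta> \<in> F" and "Max (?ht ` F) = ?ht \<eta>" by (rule imageE)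
  then have max: "\<And>\<theta>. \<theta> \<in> F \<Longrightarrow> ?ht \<theta> \<le> ?ht \<eta>"
    using \<open>finite F\<close> by (metis Max_ge finite_imageI imageI)
  from \<open>\<eta> \<in> F\<close> have \<eta>: "\<eta> \<in> \<Phi>" "\<eta> \<bullet> \<eta> \<noteq> long_sq" and \<eta>supp: "\<And>\<alpha>. \<alpha> \<in> \<Delta> \<Longrightarrow> \<alpha> \<bullet> \<alpha> = long_sq \<Longrightarrow> coeff \<eta> \<alpha> = 0"
    and above: "\<And>\<alpha>. \<alpha> \<in> \<Delta> \<Longrightarrow> coeff \<gamma> \<alpha> \<le> coeff \<eta> \<alpha>"
    by (auto simp: F_def)
  have \<eta>nonneg: "0 \<le> coeff \<eta> \<alpha>" if "\<alpha> \<in> \<Delta>" for \<alpha> using above nonneg that by force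
  \<comment> \<open>Reflecting in a short simple root with negative inner product would stay in
    \<open>F\<close> and raise the height.\<close>
  have dominant: "\<eta> \<bullet> \<alpha> \<ge> 0" if \<alpha>: "\<alpha> \<in> \<Delta>" "\<alpha> \<bullet> \<alpha> \<noteq> long_sq" for \<alpha>
  proof (rule ccontr)
    assume "\<not> \<eta> \<bullet> \<alpha> \<ge> 0"
    then have k: "2 * (\<eta> \<bullet> \<alpha>) / (\<alpha> \<bullet> \<alpha>) < 0"
      using root_sq_pos[OF simple_root[OF \<alpha>(1)]] by (simp add: divide_neg_pos)
    have c: "coeff (reflection \<alpha> \<eta>) \<epsilon> = coeff \<eta> \<epsilon> - (if \<epsilon> = \<alpha> then 2 * (\<eta> \<bullet> \<alpha>) / (\<alpha> \<bullet> \<alpha>) else 0)" for \<epsilon>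
      using \<alpha> \<eta> by (simp add: coeff_reflection root_span)
    have "coeff \<eta> \<epsilon> \<le> coeff (reflection \<alpha> \<eta>) \<epsilon>" for \<epsilon> using k by (simp add: c)
    then have "\<forall>\<epsilon>\<in>\<Delta>. coeff \<gamma> \<epsilon> \<le> coeff (reflection \<alpha> \<eta>) \<epsilon>" using above order_trans by blast
    moreover have "\<forall>\<epsilon>\<in>\<Delta>. \<epsilon> \<bullet> \<epsilon> = long_sq \<longrightarrow> coeff (reflection \<alpha> \<eta>) \<epsilon> = 0"
      using \<eta>supp \<alpha> by (auto simp: c)
    ultimately have "reflection \<alpha> \<eta> \<in> F"
      using \<eta> \<alpha> by (simp add: F_def reflection_root simple_root)
    from max[OF this] show False
      using k finite_simple \<alpha> by (simp add: c sum_subtractf)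
  qed
  have "\<exists>\<delta>\<in>\<Delta>. \<delta> \<bullet> \<delta> = long_sq \<and> \<delta> \<bullet> \<eta> < 0"
  proof (rule ccontr)
    assume no: "\<not> ?thesis"
    let ?A = "{\<alpha> \<in> \<Delta>. coeff \<eta> \<alpha> \<noteq> 0}" and ?B = "{\<alpha> \<in> \<Delta>. coeff \<eta> \<alpha> = 0}"
    show False
    proof (rule simple_connected[of ?A ?B])
      show "?A \<noteq> {}" using coeff_eq_0_imp[of \<eta>] \<eta> root_span root_nonzero by blast
      show "?B \<noteq> {}" using ex_long_simple \<eta>supp by (metis (mono_tags, lifting) empty_iff mem_Collect_eq)
      show "a \<bullet> b = 0" if a: "a \<in> ?A" and b: "b \<in> ?B" for a b
      proof -
        \<comment> \<open>For \<open>b\<close> outside the support all summands of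
          \<open>\<eta> \<bullet> b\<close> are nonpositive while the sum is nonnegative; hence
          every summand vanishes.\<close>
        have np: "coeff \<eta> \<epsilon> * (\<epsilon> \<bullet> b) \<le> 0" if "\<epsilon> \<in> \<Delta>" for \<epsilon>
          using simple_obtuse[of b \<epsilon>] \<eta>nonneg[OF that] that b
          by (cases "\<epsilon> = b") (auto simp: mult_nonneg_nonpos)
        have "\<eta> \<bullet> b \<ge> 0" using dominant[of b] no b by (force simp: inner_commute)
        then have "(\<Sum>\<epsilon>\<in>\<Delta>. coeff \<eta> \<epsilon> * (\<epsilon> \<bullet> b)) \<ge> 0" using inner_coeff[OF root_span[OF \<eta>(1)]] by simp
        then have "(\<Sum>\<epsilon>\<in>\<Delta>. - (coeff \<eta> \<epsilon> * (\<epsilon> \<bullet> b))) = 0"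
          using sum_nonpos[of \<Delta> "\<lambda>\<epsilon>. coeff \<eta> \<epsilon> * (\<epsilon> \<bullet> b)"] np by (simp add: sum_negf)
        then have "coeff \<eta> a * (a \<bullet> b) = 0"
          using a np finite_simple by (subst (asm) sum_nonneg_eq_0_iff) auto
        then show ?thesis using a by simp
      qed
    qed auto
  qed
  then obtain \<delta> where \<delta>: "\<delta> \<in> \<Delta>" "\<delta> \<bullet> \<delta> = long_sq" "\<delta> \<bullet> \<eta> < 0" by blast
  let ?T = "{\<alpha> \<in> \<Delta>. \<alpha> \<bullet> \<alpha> \<noteq> long_sq}"
  have "coeff \<eta> \<alpha> \<le> 1"
  proof (rule short_coeff_le_1_aux[of ?T \<delta> \<eta>])
    show "\<exists>\<alpha>\<in>\<Delta> - ?T. coeff \<delta> \<alpha> \<noteq> 0" using \<delta> by (intro bexI[of _ \<delta>]) (auto simp: coeff_simple)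
    show "\<delta> \<bullet> \<epsilon> \<le> 0" if "\<epsilon> \<in> ?T" for \<epsilon> using simple_obtuse[of \<epsilon> \<delta>] that \<delta> by auto
  qed (use \<delta> \<eta> \<eta>supp \<eta>nonneg simple_root \<open>\<alpha> \<in> \<Delta>\<close> in auto)
  then show ?thesis using above \<open>\<alpha> \<in> \<Delta>\<close> by force
qed

lemma short_abs_coeff_le_1:
  assumes "\<gamma> \<in> \<Phi>" "\<gamma> \<bullet> \<gamma> \<noteq> long_sq"
    and "\<And>\<alpha>. \<alpha> \<in> \<Delta> \<Longrightarrow> \<alpha> \<bullet> \<alpha> = long_sq \<Longrightarrow> coeff \<gamma> \<alpha> = 0"
    and "\<alpha> \<in> \<Delta>"
  shows "\<bar>coeff \<gamma> \<alpha>\<bar> \<le> 1"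
proof (cases "\<forall>\<alpha>\<in>\<Delta>. 0 \<le> coeff \<gamma> \<alpha>")
  case True
  then show ?thesis using short_coeff_le_1_nonneg[of \<gamma> \<alpha>] assms by auto
next
  case False
  then have "\<forall>\<alpha>\<in>\<Delta>. coeff \<gamma> \<alpha> \<le> 0" using coeff_sign assms by blast
  then show ?thesis
    using short_coeff_le_1_nonneg[of "- \<gamma>" \<alpha>] assms by (auto simp: minus_root coeff_uminus root_span)
qed

text \<open>Modulo the long lattice the reflections in long simple roots act trivially.\<close>

lemma short_root_congruent:
  assumes "\<gamma> \<in> \<Phi>" "\<gamma> \<bullet> \<gamma> \<noteq> long_sq"
  obtains \<eta> where "\<eta> \<in> \<Phi>" "\<eta> \<bullet> \<eta> = \<gamma> \<bullet> \<gamma>" "\<gamma> - \<eta> \<in> long_lattice"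
    "\<And>\<alpha>. \<alpha> \<in> \<Delta> \<Longrightarrow> \<alpha> \<bullet> \<alpha> = long_sq \<Longrightarrow> coeff \<eta> \<alpha> = 0"
proof -
  have "\<exists>\<eta>\<in>\<Phi>. \<eta> \<bullet> \<eta> = \<gamma> \<bullet> \<gamma> \<and> \<gamma> - \<eta> \<in> long_lattice \<and>
      (\<forall>\<alpha>\<in>\<Delta>. \<alpha> \<bullet> \<alpha> = long_sq \<longrightarrow> coeff \<eta> \<alpha> = 0)"
    using assms
  proof (induction rule: root_induct)
    case (simple \<alpha>)
    have "\<alpha> - \<alpha> \<in> long_lattice" by (simp add: long_lattice_def representation_zero span_zero)
    then show ?case using simple by (intro bexI[of _ \<alpha>]) (auto simp: coeff_simple simple_root)
  next
    case (reflection \<alpha> \<gamma>)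
    then obtain \<eta> where \<eta>: "\<eta> \<in> \<Phi>" "\<eta> \<bullet> \<eta> = \<gamma> \<bullet> \<gamma>" "\<gamma> - \<eta> \<in> long_lattice"
      "\<forall>\<alpha>\<in>\<Delta>. \<alpha> \<bullet> \<alpha> = long_sq \<longrightarrow> coeff \<eta> \<alpha> = 0"
      by auto
    show ?case
    proof (cases "\<alpha> \<bullet> \<alpha> = long_sq")
      case True
      \<comment> \<open>A long reflection moves \<gamma> by an integral multiple of a long simple
        root, which lies in the lattice, so \<eta> is kept.\<close>
      let ?m = "2 * (\<gamma> \<bullet> \<alpha>) / (\<alpha> \<bullet> \<alpha>)"
      have "?m *\<^sub>R \<alpha> \<in> long_lattice"
        using reflection True long_sq_pos cartan_integer[of \<alpha> \<gamma>]
        by (auto simp: long_lattice_def span_scale span_base coeff_scale coeff_simple simple_root)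
      from long_lattice_diff[OF \<eta>(3) this] have "reflection \<alpha> \<gamma> - \<eta> \<in> long_lattice"
        by (simp add: reflection_def algebra_simps)
      then show ?thesis using \<eta> by (intro bexI[of _ \<eta>]) auto
    next
      case False
      \<comment> \<open>A short reflection is applied to \<gamma> and \<eta> alike; it leaves the
        coefficients of \<eta> at long simple roots unchanged.\<close>
      have "reflection \<alpha> \<gamma> - reflection \<alpha> \<eta> \<in> long_lattice"
        using long_lattice_reflection[OF \<eta>(3)] reflection by (simp add: reflection_diff)
      then show ?thesis
        using False \<eta> reflection
        by (intro bexI[of _ "reflection \<alpha> \<eta>"])
          (auto simp: coeff_reflection root_span reflection_root simple_root)
    qed
  qed
  then show ?thesis using that by blast
qed

section \<open>Constructing a long root with prescribed coefficients\<close>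

lemma long_root_lattice: "\<gamma> \<in> \<Phi> \<Longrightarrow> \<gamma> \<bullet> \<gamma> = long_sq \<Longrightarrow> \<gamma> \<in> long_lattice"
  using coroot_coeff_int[of \<gamma>] by (simp add: long_lattice_def root_span)

text \<open>The witness is \<open>\<beta> - \<eta>\<close> with \<eta> from
  \<open>short_root_congruent\<close>; it lies in the lattice, and \<open>long_lattice_root\<close>
  makes it a root once its norm is known.\<close>

lemma agreeing_long_root:
  assumes \<beta>: "\<beta> \<in> \<Phi>" "\<beta> \<bullet> \<beta> \<noteq> long_sq" and "S \<subseteq> \<Delta>"
    and supp: "\<exists>\<alpha>\<in>S. coeff \<beta> \<alpha> \<noteq> 0"
    and int: "\<And>\<alpha>. \<alpha> \<in> S \<Longrightarrow> \<alpha> \<bullet> \<alpha> \<noteq> long_sq \<Longrightarrow> coeff \<beta> \<alpha> * (\<alpha> \<bullet> \<alpha>) / long_sq \<in> \<int>"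
  obtains \<gamma> where "\<gamma> \<in> \<Phi>" "\<gamma> \<bullet> \<gamma> = long_sq" "\<And>\<alpha>. \<alpha> \<in> S \<Longrightarrow> coeff \<gamma> \<alpha> = coeff \<beta> \<alpha>"
proof -
  obtain \<eta> where \<eta>: "\<eta> \<in> \<Phi>" "\<eta> \<bullet> \<eta> = \<beta> \<bullet> \<beta>" "\<beta> - \<eta> \<in> long_lattice"
    and \<eta>supp: "\<And>\<alpha>. \<alpha> \<in> \<Delta> \<Longrightarrow> \<alpha> \<bullet> \<alpha> = long_sq \<Longrightarrow> coeff \<eta> \<alpha> = 0"
    using short_root_congruent[OF \<beta>] by metis
  have \<eta>S: "coeff \<eta> \<alpha> = 0" if "\<alpha> \<in> S" for \<alpha>
  proof (cases "\<alpha> \<bullet> \<alpha> = long_sq")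
    case True
    then show ?thesis using \<eta>supp that \<open>S \<subseteq> \<Delta>\<close> by blast
  next
    case False
    have \<alpha>: "\<alpha> \<in> \<Delta>" "\<alpha> \<in> \<Phi>" using that \<open>S \<subseteq> \<Delta>\<close> simple_root by auto
    have "coeff \<eta> \<alpha> * (\<alpha> \<bullet> \<alpha>) / long_sq =
        coeff \<beta> \<alpha> * (\<alpha> \<bullet> \<alpha>) / long_sq - coeff (\<beta> - \<eta>) \<alpha> * (\<alpha> \<bullet> \<alpha>) / long_sq"
      using \<beta> \<eta> by (simp add: coeff_diff root_span left_diff_distrib diff_divide_distrib)
    also have "\<dots> \<in> \<int>" using int[OF that False] long_lattice_int[OF \<eta>(3) \<alpha>(1)] by (rule Ints_diff)
    finally obtain k :: int where k: "coeff \<eta> \<alpha> * (\<alpha> \<bullet> \<alpha>) / long_sq = of_int k"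
      by (elim Ints_cases)
    \<comment> \<open>A short square norm is at most half of \<open>long_sq\<close>, so the rescaled
      coefficient is at most one half in absolute value; being an integer, it is 0.\<close>
    have "\<bar>coeff \<eta> \<alpha>\<bar> \<le> 1" using short_abs_coeff_le_1[of \<eta> \<alpha>] \<eta> \<beta> \<eta>supp \<alpha> by auto
    then have "\<bar>coeff \<eta> \<alpha>\<bar> * (\<alpha> \<bullet> \<alpha>) \<le> 1 * (\<alpha> \<bullet> \<alpha>)" by (intro mult_right_mono) auto
    also have "\<dots> < long_sq" using long_ge_twice_short[OF \<alpha>(2) False] root_sq_pos[OF \<alpha>(2)] by linarith
    finally have "\<bar>coeff \<eta> \<alpha> * (\<alpha> \<bullet> \<alpha>) / long_sq\<bar> < 1"
      using long_sq_pos by (simp add: abs_mult)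
    then have "k = 0" unfolding k by linarith
    then show ?thesis using k root_sq_pos[OF \<alpha>(2)] long_sq_pos by simp
  qed
  let ?v = "\<beta> - \<eta>"
  have vS: "coeff ?v \<alpha> = coeff \<beta> \<alpha>" if "\<alpha> \<in> S" for \<alpha>
    using that \<beta> \<eta> \<eta>S by (simp add: coeff_diff root_span)
  have pos: "\<eta> \<bullet> \<eta> > 0" using root_sq_pos[OF \<eta>(1)] .
  \<comment> \<open>\<eta> vanishes on \<open>S\<close>, whereas \<beta> does not.\<close>
  have "\<beta> \<noteq> \<eta>" "\<beta> \<noteq> - \<eta>"
    using supp \<eta>S \<eta> by (auto simp: coeff_uminus root_span)
  then have "\<bar>2 * (\<beta> \<bullet> \<eta>) / (\<eta> \<bullet> \<eta>)\<bar> \<le> 1"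
    by (intro abs_cartan_le_1) (use \<eta>(2) pos cartan_integer[OF \<eta>(1) \<beta>(1)] in auto)
  then have "2 * \<bar>\<beta> \<bullet> \<eta>\<bar> \<le> \<eta> \<bullet> \<eta>" using pos by (simp add: abs_mult)
  moreover have "?v \<bullet> ?v = 2 * (\<eta> \<bullet> \<eta>) - 2 * (\<beta> \<bullet> \<eta>)"
    using \<eta> by (simp add: inner_diff_left inner_diff_right inner_commute)
  moreover have "2 * (\<eta> \<bullet> \<eta>) \<le> long_sq" using long_ge_twice_short[OF \<eta>(1)] \<eta> \<beta> by simp
  \<comment> \<open>The square norm of \<open>?v\<close> lies between that of \<eta> and three times
    that of \<eta>, hence below \<open>2 * long_sq\<close>; the only positive multiple of
    \<open>long_sq\<close> in this range is \<open>long_sq\<close> itself.\<close>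
  ultimately have "0 < ?v \<bullet> ?v" "?v \<bullet> ?v < 2 * long_sq" using pos by linarith+
  moreover obtain n :: int where n: "?v \<bullet> ?v / long_sq = of_int n"
    using long_lattice_norm[OF \<eta>(3)] by (elim Ints_cases)
  ultimately have "0 < (of_int n :: real)" "of_int n < (2 :: real)"
    using long_sq_pos unfolding n[symmetric] by (simp_all add: field_simps)
  then have "n = 1" by linarith
  then have "?v \<bullet> ?v = long_sq" using n long_sq_pos by (simp add: field_simps)
  then show ?thesis using that[of ?v] long_lattice_root[OF \<eta>(3)] vS by blast
qed

text \<open>By \<open>lacing_number_eq\<close>, divisibility by the lacing number is the integrality
  condition that defines \<open>long_lattice\<close> at \<alpha>.\<close>

lemma multiple_lacing_number_iff:
  assumes "\<alpha> \<in> \<Phi>" "\<alpha> \<bullet> \<alpha> \<noteq> long_sq"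
  shows "(\<exists>k::int. c = of_int k * lacing_number \<Phi>) \<longleftrightarrow> c * (\<alpha> \<bullet> \<alpha>) / long_sq \<in> \<int>"
proof -
  have "c = k * (l / a) \<longleftrightarrow> c * a / l = k" if "l > 0" "a > 0" for k l a :: real
    using that by (simp add: field_simps)
  from this[OF long_sq_pos root_sq_pos[OF assms(1)]] show ?thesis
    by (auto simp: lacing_number_eq[OF assms] Ints_def)
qed

end

theorem proposition4p14:
  fixes \<Phi> \<Delta> S :: "'a::euclidean_space set" and \<beta> :: 'a
  assumes "irreducible_root_system \<Phi>"
    and "simple_system \<Phi> \<Delta>"
    and "S \<subseteq> \<Delta>"
    and "\<beta> \<in> \<Phi>"
    and "S \<inter> root_supp \<Delta> \<beta> \<noteq> {}"
  shows "(\<exists>\<gamma>\<in>roots_agreeing \<Phi> \<Delta> S \<beta>. long_root \<Phi> \<gamma>) \<longleftrightarrow>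
    (\<forall>\<alpha>\<in>S. short_root \<Phi> \<alpha> \<longrightarrow>
       (\<exists>k::int. representation \<Delta> \<beta> \<alpha> = of_int k * lacing_number \<Phi>))"
proof -
  interpret irreducible_based_roots \<Phi> \<Delta>
    using assms by unfold_locales
  have "(\<forall>\<alpha>\<in>S. short_root \<Phi> \<alpha> \<longrightarrow> (\<exists>k::int. coeff \<beta> \<alpha> = of_int k * lacing_number \<Phi>)) \<longleftrightarrow>
      (\<forall>\<alpha>\<in>S. \<alpha> \<bullet> \<alpha> \<noteq> long_sq \<longrightarrow> coeff \<beta> \<alpha> * (\<alpha> \<bullet> \<alpha>) / long_sq \<in> \<int>)"
  proof (intro ball_cong refl)
    fix \<alpha> assume "\<alpha> \<in> S"
    then have "\<alpha> \<in> \<Phi>" using assms(3) simple_root by blast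
    then show "(short_root \<Phi> \<alpha> \<longrightarrow> (\<exists>k::int. coeff \<beta> \<alpha> = of_int k * lacing_number \<Phi>)) \<longleftrightarrow>
        (\<alpha> \<bullet> \<alpha> \<noteq> long_sq \<longrightarrow> coeff \<beta> \<alpha> * (\<alpha> \<bullet> \<alpha>) / long_sq \<in> \<int>)"
      using multiple_lacing_number_iff[of \<alpha> "coeff \<beta> \<alpha>"] by (auto simp: short_root_def long_root_iff)
  qed
  moreover have "(\<exists>\<gamma>\<in>roots_agreeing \<Phi> \<Delta> S \<beta>. long_root \<Phi> \<gamma>) \<longleftrightarrow>
      (\<forall>\<alpha>\<in>S. \<alpha> \<bullet> \<alpha> \<noteq> long_sq \<longrightarrow> coeff \<beta> \<alpha> * (\<alpha> \<bullet> \<alpha>) / long_sq \<in> \<int>)" (is "?L \<longleftrightarrow> ?R")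
  proof
    assume ?L
    \<comment> \<open>Agreement on \<open>S\<close> transfers the integrality conditions from the
      long root \<gamma> to \<beta>.\<close>
    then obtain \<gamma> where "\<gamma> \<in> long_lattice" "\<forall>\<alpha>\<in>S. coeff \<gamma> \<alpha> = coeff \<beta> \<alpha>"
      by (auto simp: roots_agreeing_def long_root_iff intro: long_root_lattice)
    then show ?R using assms(3) long_lattice_int by (metis subsetD)
  next
    assume R: ?R
    show ?L
    proof (cases "\<beta> \<bullet> \<beta> = long_sq")
      case True
      then show ?thesis using assms(4) by (auto simp: roots_agreeing_def long_root_iff)
    next
      case False
      have "\<exists>\<alpha>\<in>S. coeff \<beta> \<alpha> \<noteq> 0" using assms(5) by (auto simp: root_supp_def)
      then obtain \<gamma> where "\<gamma> \<in> \<Phi>" "\<gamma> \<bullet> \<gamma> = long_sq" "\<And>\<alpha>. \<alpha> \<in> S \<Longrightarrow> coeff \<gamma> \<alpha> = coeff \<beta> \<alpha>"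
        using agreeing_long_root[of \<beta> S] False R assms(3,4) by metis
      then show ?thesis by (auto simp: roots_agreeing_def long_root_iff)
    qed
  qed
  ultimately show ?thesis by simp
qed

end
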